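(* Let $\Omega$ be an infinite set and let $\mathcal{T}_P$ denote the pointwise topology on $\Omega^\Omega$. For each cardinal $\lambda$ with $1<\lambda\le|\Omega|$ let $I_\lambda=\{f\in\Omega^\Omega : |(\Omega)f|<\lambda\}$, $$\mathcal{T}_{I_\lambda^1}=\{A : A\subseteq\Omega^\Omega\setminus I_\lambda\}\cup\{\Omega^\Omega\},\qquad \mathcal{T}_{I_\lambda^2}=\mathcal{T}_{I_\lambda^1}\cup\{A\cup I_\lambda : A\in\mathcal{T}_{I_\lambda^1}\},$$ and for $i\in\{1,2\}$ let $\mathcal{T}_{P\cup I_\lambda^i}$ be the topology on $\Omega^\Omega$ generated by $\mathcal{T}_P$ and $\mathcal{T}_{I_\lambda^i}$. Then $\mathcal{T}_P$ and all the $\mathcal{T}_{P\cup I_\lambda^i}$ ($i\in\{1,2\}$, $1<\lambda\le|\Omega|$) are Hausdorff topologies with respect to which $\Omega^\Omega$ is a topological semigroup, and they satisfy the following strict inclusions: (a) $\mathcal{T}_P\subsetneq\mathcal{T}_{P\cup I_\lambda^i}$ for all $i\in\{1,2\}$ and all cardinals $1<\lambda\le|\Omega|$; (b) $\mathcal{T}_{P\cup I_\kappa^i}\subsetneq\mathcal{T}_{P\cup I_\lambda^i}$ for all $i\in\{1,2\}$ and all cardinals $1<\lambda<\kappa\le|\Omega|$; (c) $\mathcal{T}_{P\cup I_\lambda^1}\subsetneq\mathcal{T}_{P\cup I_\lambda^2}$ for all cardinals $1<\lambda\le|\Omega|$. Moreover, $\mathcal{T}_{P\cup I_2^2}$ is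 the discrete topology.
   Context: $\Omega^\Omega$ is the monoid of all functions $\Omega\to\Omega$ under composition, with functions written on the right, so $(\Omega)f$ is the image of $f$. The pointwise topology on $\Omega^\Omega$ is the product topology on $\prod_\Omega\Omega$ with each factor $\Omega$ discrete. The index $\lambda$ ranges over all cardinals, finite or infinite, in the stated range. A semigroup $S$ with a topology is a topological semigroup if multiplication $S\times S\to S$ is continuous for the product topology on $S\times S$. *)

theory Defs
  imports "HOL-Analysis.Analysis"
begin

unbundle cardinal_syntax

text \<open>
  Cardinals are the \<open>Card_order\<close> relations of the HOL cardinal library, compared by
  \<open><o\<close> and \<open>\<le>o\<close> and identified up to \<open>=o\<close>.  Every cardinal at most that of a set
  \<open>\<Omega> :: 'a set\<close>, finite or infinite, has a representative of type \<open>'a rel\<close>, so quantifying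
  over \<open>\<mu> :: 'a rel\<close> reaches all of them.

  The set of self-maps of \<open>\<Omega>\<close> is \<open>\<Omega> \<rightarrow>\<^sub>E \<Omega>\<close>, whose elements are extended by
  \<open>undefined\<close> outside \<open>\<Omega>\<close> so that equality is equality on \<open>\<Omega>\<close>.
\<close>

definition cardinals_upto :: "'a set \<Rightarrow> 'a rel set" where
  "cardinals_upto \<Omega> = {\<mu>. Card_order \<mu> \<and> cone <o \<mu> \<and> \<mu> \<le>o |\<Omega>|}"

text \<open>Maps are written on the right: the product \<open>f g\<close> means \<open>f\<close> first, then \<open>g\<close>.\<close>

definition self_map_mult :: "'a set \<Rightarrow> ('a \<Rightarrow> 'a) \<Rightarrow> ('a \<Rightarrow> 'a) \<Rightarrow> ('a \<Rightarrow> 'a)" where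
  "self_map_mult \<Omega> f g = compose \<Omega> g f"

definition topological_semigroup :: "'b set \<Rightarrow> ('b \<Rightarrow> 'b \<Rightarrow> 'b) \<Rightarrow> 'b topology \<Rightarrow> bool" where
  "topological_semigroup S m X \<longleftrightarrow>
     topspace X = S \<and>
     (\<forall>x\<in>S. \<forall>y\<in>S. m x y \<in> S) \<and>
     (\<forall>x\<in>S. \<forall>y\<in>S. \<forall>z\<in>S. m (m x y) z = m x (m y z)) \<and>
     continuous_map (prod_topology X X) X (\<lambda>(x, y). m x y)"

definition opens :: "'b topology \<Rightarrow> 'b set set" where
  "opens X = {U. openin X U}"

definition T_P :: "'a set \<Rightarrow> ('a \<Rightarrow> 'a) topology" where
  "T_P \<Omega> = product_topology (\<lambda>_. discrete_topology \<Omega>) \<Omega>"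

definition I_card :: "'a set \<Rightarrow> 'c rel \<Rightarrow> ('a \<Rightarrow> 'a) set" where
  "I_card \<Omega> \<mu> = {f \<in> \<Omega> \<rightarrow>\<^sub>E \<Omega>. |f ` \<Omega>| <o \<mu>}"

definition T_I1 :: "'a set \<Rightarrow> 'c rel \<Rightarrow> ('a \<Rightarrow> 'a) set set" where
  "T_I1 \<Omega> \<mu> = {A. A \<subseteq> (\<Omega> \<rightarrow>\<^sub>E \<Omega>) - I_card \<Omega> \<mu>} \<union> {\<Omega> \<rightarrow>\<^sub>E \<Omega>}"

definition T_I2 :: "'a set \<Rightarrow> 'c rel \<Rightarrow> ('a \<Rightarrow> 'a) set set" where
  "T_I2 \<Omega> \<mu> = T_I1 \<Omega> \<mu> \<union> {A \<union> I_card \<Omega> \<mu> | A. A \<in> T_I1 \<Omega> \<mu>}"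

text \<open>The index \<open>i\<close> below is only ever 1 or 2; the generating family is a subbase.\<close>

definition T_PI :: "nat \<Rightarrow> 'a set \<Rightarrow> 'c rel \<Rightarrow> ('a \<Rightarrow> 'a) topology" where
  "T_PI i \<Omega> \<mu> =
     topology_generated_by (opens (T_P \<Omega>) \<union> (if i = 1 then T_I1 \<Omega> \<mu> else T_I2 \<Omega> \<mu>))"

end

theory Submission
  imports Defs
begin

\<comment> \<open>This notation makes every use of \<open>=o\<close> between cardinals ambiguous.\<close>
no_notation Set_Algebras.elt_set_eq (infix \<open>=o\<close> 50)

text \<open>
  Write \<open>M\<close> for the monoid of self-maps and \<open>I\<close> for \<open>I\<^sub>\<lambda>\<close>.  A set \<open>U\<close> is open for \<open>i = 2\<close> iff
  \<open>U \<inter> I\<close> is relatively open in \<open>I\<close> for the pointwise topology, and open for \<open>i = 1\<close> iff \<open>U\<close> is a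
  pointwise neighbourhood of every point of \<open>U \<inter> I\<close>; points outside \<open>I\<close> are isolated.  Since
  \<open>I\<close> is an ideal, a product lies outside \<open>I\<close> only if both factors are isolated, and
  otherwise continuity is inherited from the pointwise topology.  Strictness comes from
  perturbing a map outside a finite set of points while controlling the size of its image.
\<close>

section \<open>Basic neighbourhoods in the pointwise topology\<close>

lemma opens_psubsetI:
  assumes "\<And>U. openin X U \<Longrightarrow> openin Y U" "openin Y V" "\<not> openin X V"
  shows "opens X \<subset> opens Y"
  using assms by (auto simp: opens_def)

text \<open>For finite \<open>F\<close> contained in \<open>\<Omega>\<close> these sets form a
  neighbourhood base at \<open>f\<close> in the pointwise topology; finiteness is imposed where they
  are used.\<close>

definition agree :: "'a set \<Rightarrow> ('a \<Rightarrow> 'a) \<Rightarrow> 'a set \<Rightarrow> ('a \<Rightarrow> 'a) set" where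
  "agree \<Omega> f F = {g \<in> \<Omega> \<rightarrow>\<^sub>E \<Omega>. \<forall>x\<in>F. g x = f x}"

lemma topspace_T_P [simp]: "topspace (T_P \<Omega>) = \<Omega> \<rightarrow>\<^sub>E \<Omega>"
  by (simp add: T_P_def)

lemma openin_agree:
  assumes "f \<in> \<Omega> \<rightarrow>\<^sub>E \<Omega>" "finite F" "F \<subseteq> \<Omega>"
  shows "openin (T_P \<Omega>) (agree \<Omega> f F)"
proof -
  \<comment> \<open>The set is a box: singleton factors over \<open>F\<close>, the full factor
    \<open>\<Omega>\<close> elsewhere.\<close>
  define B where "B x = (if x \<in> F then {f x} else \<Omega>)" for x
  have B: "agree \<Omega> f F = (\<Pi>\<^sub>E x\<in>\<Omega>. B x)"
  proof (rule set_eqI)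
    fix g
    have "(\<forall>x\<in>\<Omega>. g x \<in> B x) \<longleftrightarrow> (\<forall>x\<in>\<Omega>. g x \<in> \<Omega>) \<and> (\<forall>x\<in>F. g x = f x)"
      using assms(1,3) unfolding B_def PiE_iff by (metis singletonD singletonI subsetD)
    then show "g \<in> agree \<Omega> f F \<longleftrightarrow> g \<in> (\<Pi>\<^sub>E x\<in>\<Omega>. B x)"
      unfolding agree_def PiE_iff by blast
  qed
  have "finite {x \<in> \<Omega>. B x \<noteq> \<Omega>}"
    by (rule finite_subset[OF _ assms(2)]) (auto simp: B_def)
  moreover have "B x \<subseteq> \<Omega>" if "x \<in> \<Omega>" for x
    using assms that by (auto simp: B_def)
  ultimately show ?thesis
    by (simp add: T_P_def B openin_PiE_gen)
qed

text \<open>A basic box around \<open>f\<close> restricts only finitely many coordinates, and any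
  map that shares the values of \<open>f\<close> at those coordinates stays in the box.\<close>

lemma openin_T_P_agree:
  assumes "openin (T_P \<Omega>) U" "f \<in> U"
  obtains F where "finite F" "F \<subseteq> \<Omega>" "agree \<Omega> f F \<subseteq> U"
proof -
  obtain B where B: "finite {x \<in> \<Omega>. B x \<noteq> \<Omega>}" "f \<in> Pi\<^sub>E \<Omega> B" "Pi\<^sub>E \<Omega> B \<subseteq> U"
    using assms unfolding T_P_def openin_product_topology_alt by auto
  have "agree \<Omega> f {x \<in> \<Omega>. B x \<noteq> \<Omega>} \<subseteq> Pi\<^sub>E \<Omega> B"
  proof
    fix g assume g: "g \<in> agree \<Omega> f {x \<in> \<Omega>. B x \<noteq> \<Omega>}"
    have "g x \<in> B x" if "x \<in> \<Omega>" for x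
      using g B(2) that by (cases "B x = \<Omega>") (auto simp: agree_def PiE_iff)
    then show "g \<in> Pi\<^sub>E \<Omega> B"
      using g by (auto simp: agree_def PiE_iff)
  qed
  with B show ?thesis
    by (intro that[of "{x \<in> \<Omega>. B x \<noteq> \<Omega>}"]) auto
qed

lemma Hausdorff_T_P: "Hausdorff_space (T_P \<Omega>)"
  by (simp add: T_P_def Hausdorff_space_product_topology Hausdorff_space_discrete_topology)

section \<open>Continuity of composition in the pointwise topology\<close>

lemma self_map_mult_closed:
  assumes "f \<in> \<Omega> \<rightarrow>\<^sub>E \<Omega>" "g \<in> \<Omega> \<rightarrow>\<^sub>E \<Omega>"
  shows "self_map_mult \<Omega> f g \<in> \<Omega> \<rightarrow>\<^sub>E \<Omega>"
  using assms by (auto simp: self_map_mult_def compose_def PiE_iff)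

text \<open>Closure and associativity do not depend on the topology and are settled here once. What
  remains for each topology is to find an open rectangle around every pair whose product lies in a
  given open set.\<close>

lemma topological_semigroupI:
  assumes top: "topspace X = \<Omega> \<rightarrow>\<^sub>E \<Omega>"
    and cont: "\<And>f g U. \<lbrakk>f \<in> \<Omega> \<rightarrow>\<^sub>E \<Omega>; g \<in> \<Omega> \<rightarrow>\<^sub>E \<Omega>; openin X U; self_map_mult \<Omega> f g \<in> U\<rbrakk>
      \<Longrightarrow> \<exists>V W. openin X V \<and> openin X W \<and> f \<in> V \<and> g \<in> W
            \<and> (\<forall>f'\<in>V. \<forall>g'\<in>W. self_map_mult \<Omega> f' g' \<in> U)"
  shows "topological_semigroup (\<Omega> \<rightarrow>\<^sub>E \<Omega>) (self_map_mult \<Omega>) X"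
  unfolding topological_semigroup_def
proof (intro conjI ballI)
  show "self_map_mult \<Omega> (self_map_mult \<Omega> f g) h = self_map_mult \<Omega> f (self_map_mult \<Omega> g h)"
    if "f \<in> \<Omega> \<rightarrow>\<^sub>E \<Omega>" "g \<in> \<Omega> \<rightarrow>\<^sub>E \<Omega>" "h \<in> \<Omega> \<rightarrow>\<^sub>E \<Omega>" for f g h
    using that by (auto simp: self_map_mult_def compose_def fun_eq_iff PiE_iff)
  show "continuous_map (prod_topology X X) X (\<lambda>(x, y). self_map_mult \<Omega> x y)"
    unfolding continuous_map
  proof (intro conjI allI impI)
    show "(\<lambda>(x, y). self_map_mult \<Omega> x y) ` topspace (prod_topology X X) \<subseteq> topspace X"
      by (simp add: top image_subset_iff self_map_mult_closed del: PiE_iff)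
    fix U assume U: "openin X U"
    show "openin (prod_topology X X)
            {p \<in> topspace (prod_topology X X). (case p of (x, y) \<Rightarrow> self_map_mult \<Omega> x y) \<in> U}"
      unfolding openin_prod_topology_alt
    proof (intro allI impI)
      fix f g
      assume "(f, g) \<in> {p \<in> topspace (prod_topology X X).
                 (case p of (x, y) \<Rightarrow> self_map_mult \<Omega> x y) \<in> U}"
      then obtain V W where VW: "openin X V" "openin X W" "f \<in> V" "g \<in> W"
        "\<forall>f'\<in>V. \<forall>g'\<in>W. self_map_mult \<Omega> f' g' \<in> U"
        using cont[OF _ _ U, of f g] by (auto simp: top)
      then show "\<exists>V W. openin X V \<and> openin X W \<and> f \<in> V \<and> g \<in> W \<and>
        V \<times> W \<subseteq> {p \<in> topspace (prod_topology X X). (case p of (x, y) \<Rightarrow> self_map_mult \<Omega> x y) \<in> U}"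
        using openin_subset[OF VW(1)] openin_subset[OF VW(2)]
        by (intro exI[of _ V] exI[of _ W]) auto
    qed
  qed
qed (simp_all add: top self_map_mult_closed)

lemma T_P_mult_nhds:
  assumes fg: "f \<in> \<Omega> \<rightarrow>\<^sub>E \<Omega>" "g \<in> \<Omega> \<rightarrow>\<^sub>E \<Omega>" and U: "openin (T_P \<Omega>) U" "self_map_mult \<Omega> f g \<in> U"
  obtains V W where "openin (T_P \<Omega>) V" "openin (T_P \<Omega>) W" "f \<in> V" "g \<in> W"
    "\<forall>f'\<in>V. \<forall>g'\<in>W. self_map_mult \<Omega> f' g' \<in> U"
proof -
  obtain F where F: "finite F" "F \<subseteq> \<Omega>" "agree \<Omega> (self_map_mult \<Omega> f g) F \<subseteq> U"
    using openin_T_P_agree[OF U] .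
  show ?thesis
  proof
    show "openin (T_P \<Omega>) (agree \<Omega> f F)" "openin (T_P \<Omega>) (agree \<Omega> g (f ` F))"
      using F fg by (auto intro!: openin_agree)
    show "f \<in> agree \<Omega> f F" "g \<in> agree \<Omega> g (f ` F)"
      using fg by (auto simp: agree_def)
    have "self_map_mult \<Omega> f' g' \<in> agree \<Omega> (self_map_mult \<Omega> f g) F"
      if "f' \<in> agree \<Omega> f F" "g' \<in> agree \<Omega> g (f ` F)" for f' g'
      using that F(2) self_map_mult_closed[of f' \<Omega> g']
      by (auto simp: agree_def self_map_mult_def compose_def)
    then show "\<forall>f'\<in>agree \<Omega> f F. \<forall>g'\<in>agree \<Omega> g (f ` F). self_map_mult \<Omega> f' g' \<in> U"
      using F(3) by blast
  qed
qed

lemma topological_semigroup_T_P: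
  "topological_semigroup (\<Omega> \<rightarrow>\<^sub>E \<Omega>) (self_map_mult \<Omega>) (T_P \<Omega>)"
proof (rule topological_semigroupI[OF topspace_T_P])
  fix f g U
  assume "f \<in> \<Omega> \<rightarrow>\<^sub>E \<Omega>" "g \<in> \<Omega> \<rightarrow>\<^sub>E \<Omega>" "openin (T_P \<Omega>) U" "self_map_mult \<Omega> f g \<in> U"
  from T_P_mult_nhds[OF this] obtain V W where VW: "openin (T_P \<Omega>) V" "openin (T_P \<Omega>) W"
    "f \<in> V" "g \<in> W" "\<forall>f'\<in>V. \<forall>g'\<in>W. self_map_mult \<Omega> f' g' \<in> U" .
  show "\<exists>V W. openin (T_P \<Omega>) V \<and> openin (T_P \<Omega>) W \<and> f \<in> V \<and> g \<in> W
            \<and> (\<forall>f'\<in>V. \<forall>g'\<in>W. self_map_mult \<Omega> f' g' \<in> U)"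
    by (intro exI[of _ V] exI[of _ W] conjI VW)
qed

section \<open>The ideals of maps with small image\<close>

lemma I_card_subset: "I_card \<Omega> \<mu> \<subseteq> \<Omega> \<rightarrow>\<^sub>E \<Omega>"
  by (auto simp: I_card_def)

lemma I_card_mono:
  assumes "\<mu> \<le>o \<kappa>"
  shows "I_card \<Omega> \<mu> \<subseteq> I_card \<Omega> \<kappa>"
  using assms by (auto simp: I_card_def intro: ordLess_ordLeq_trans)

text \<open>The image of the product is \<open>g\<close> f \<open>\<Omega>\<close>: as an image of
  \<open>f\<close> \<Omega>\<open>it is no larger than that set, and it is contained in\<close>g
  \<open>\<Omega>\<close>. So smallness of either factor suffices.\<close>

lemma I_card_ideal:
  assumes "f \<in> \<Omega> \<rightarrow>\<^sub>E \<Omega>" "g \<in> \<Omega> \<rightarrow>\<^sub>E \<Omega>" "f \<in> I_card \<Omega> \<mu> \<or> g \<in> I_card \<Omega> \<mu>"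
  shows "self_map_mult \<Omega> f g \<in> I_card \<Omega> \<mu>"
proof -
  have im: "self_map_mult \<Omega> f g ` \<Omega> = g ` f ` \<Omega>"
    by (auto simp: self_map_mult_def compose_def)
  have "|g ` f ` \<Omega>| \<le>o |f ` \<Omega>|"
    by (rule card_of_image)
  moreover have "|g ` f ` \<Omega>| \<le>o |g ` \<Omega>|"
    using assms(1) by (intro card_of_mono1) auto
  ultimately show ?thesis
    using assms(3) self_map_mult_closed[OF assms(1,2)] ordLeq_ordLess_trans
    unfolding I_card_def mem_Collect_eq im by blast
qed

section \<open>Open sets of the generated topologies\<close>

text \<open>Both parts hold for every \<open>i\<close> because \<open>T_I1\<close> is contained in
  \<open>T_I2\<close>; the second makes every map outside the ideal isolated.\<close>

lemma T_PI_subbase: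
  shows "openin (T_P \<Omega>) U \<Longrightarrow> openin (T_PI i \<Omega> \<mu>) U"
    and "A \<subseteq> (\<Omega> \<rightarrow>\<^sub>E \<Omega>) - I_card \<Omega> \<mu> \<Longrightarrow> openin (T_PI i \<Omega> \<mu>) A"
  unfolding T_PI_def
  by (rule topology_generated_by_Basis; simp add: opens_def T_I1_def T_I2_def)+

lemma openin_T_PI_2_I_card: "openin (T_PI 2 \<Omega> \<mu>) (I_card \<Omega> \<mu>)"
  unfolding T_PI_def
  by (rule topology_generated_by_Basis) (auto simp: T_I1_def T_I2_def)

text \<open>The condition on the right holds for the subbase and survives finite intersections and
  arbitrary unions, by intersecting or uniting the witnesses \<open>V\<close>. Conversely,
  \<open>U\<close> is the union of \<open>V\<close> and a set that misses the ideal.\<close>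

lemma openin_T_PI_1:
  "openin (T_PI 1 \<Omega> \<mu>) U \<longleftrightarrow>
     U \<subseteq> \<Omega> \<rightarrow>\<^sub>E \<Omega> \<and> (\<exists>V. openin (T_P \<Omega>) V \<and> V \<subseteq> U \<and> U \<inter> I_card \<Omega> \<mu> \<subseteq> V)"
  (is "_ \<longleftrightarrow> ?R U")
proof
  assume "openin (T_PI 1 \<Omega> \<mu>) U"
  then have "generate_topology_on (opens (T_P \<Omega>) \<union> T_I1 \<Omega> \<mu>) U"
    by (simp add: T_PI_def openin_topology_generated_by_iff)
  then show "?R U"
  proof induction
    case Empty
    then show ?case by (auto intro: exI[of _ "{}"])
  next
    case (Int A B)
    then obtain V W where "openin (T_P \<Omega>) V" "V \<subseteq> A" "A \<inter> I_card \<Omega> \<mu> \<subseteq> V"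
      "openin (T_P \<Omega>) W" "W \<subseteq> B" "B \<inter> I_card \<Omega> \<mu> \<subseteq> W" by blast
    with Int show ?case by (intro conjI exI[of _ "V \<inter> W"]) auto
  next
    case (UN K)
    then obtain V where V: "\<And>k. k \<in> K \<Longrightarrow>
        openin (T_P \<Omega>) (V k) \<and> V k \<subseteq> k \<and> k \<inter> I_card \<Omega> \<mu> \<subseteq> V k" by metis
    have "openin (T_P \<Omega>) (\<Union> (V ` K))"
      using V by auto
    moreover have "\<Union> (V ` K) \<subseteq> \<Union> K" "\<Union> K \<inter> I_card \<Omega> \<mu> \<subseteq> \<Union> (V ` K)"
      using V by blast+
    moreover have "\<Union> K \<subseteq> \<Omega> \<rightarrow>\<^sub>E \<Omega>"
      using UN by (simp add: Union_least)
    ultimately show ?case by blast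
  next
    case (Basis A)
    \<comment> \<open>The only other member of \<open>T_I1\<close> is the whole monoid, which is
      pointwise open and falls under the first case.\<close>
    consider "openin (T_P \<Omega>) A" | "A \<subseteq> (\<Omega> \<rightarrow>\<^sub>E \<Omega>) - I_card \<Omega> \<mu>"
      using Basis openin_topspace[of "T_P \<Omega>"] by (auto simp: opens_def T_I1_def)
    then show ?case
    proof cases
      case 1
      then show ?thesis using openin_subset[OF 1] by auto
    next
      case 2
      then show ?thesis by (auto intro: exI[of _ "{}"])
    qed
  qed
next
  assume "?R U"
  then obtain V where V: "openin (T_P \<Omega>) V" "V \<subseteq> U" "U \<inter> I_card \<Omega> \<mu> \<subseteq> V"
    and "U \<subseteq> \<Omega> \<rightarrow>\<^sub>E \<Omega>" by blast
  then have "openin (T_PI 1 \<Omega> \<mu>) (V \<union> (U - I_card \<Omega> \<mu>))"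
    by (intro openin_Un T_PI_subbase) auto
  moreover have "U = V \<union> (U - I_card \<Omega> \<mu>)"
    using V by auto
  ultimately show "openin (T_PI 1 \<Omega> \<mu>) U" by simp
qed

text \<open>Since the ideal is now open itself, only the trace of \<open>U\<close> on it matters,
  and traces commute with unions and intersections. The witness \<open>V\<close> may therefore leave
  \<open>U\<close> outside the ideal, unlike for index 1.\<close>

lemma openin_T_PI_2:
  "openin (T_PI 2 \<Omega> \<mu>) U \<longleftrightarrow>
     U \<subseteq> \<Omega> \<rightarrow>\<^sub>E \<Omega> \<and> (\<exists>V. openin (T_P \<Omega>) V \<and> U \<inter> I_card \<Omega> \<mu> = V \<inter> I_card \<Omega> \<mu>)"
  (is "_ \<longleftrightarrow> ?R U")
proof
  assume "openin (T_PI 2 \<Omega> \<mu>) U"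
  then have "generate_topology_on (opens (T_P \<Omega>) \<union> T_I2 \<Omega> \<mu>) U"
    by (simp add: T_PI_def openin_topology_generated_by_iff)
  then show "?R U"
  proof induction
    case Empty
    then show ?case by (auto intro: exI[of _ "{}"])
  next
    case (Int A B)
    then obtain V W where "openin (T_P \<Omega>) V" "A \<inter> I_card \<Omega> \<mu> = V \<inter> I_card \<Omega> \<mu>"
      "openin (T_P \<Omega>) W" "B \<inter> I_card \<Omega> \<mu> = W \<inter> I_card \<Omega> \<mu>" by blast
    with Int show ?case by (intro conjI exI[of _ "V \<inter> W"]) auto
  next
    case (UN K)
    then obtain V where V: "\<And>k. k \<in> K \<Longrightarrow>
        openin (T_P \<Omega>) (V k) \<and> k \<inter> I_card \<Omega> \<mu> = V k \<inter> I_card \<Omega> \<mu>" by metis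
    have "\<Union> K \<inter> I_card \<Omega> \<mu> = \<Union> (V ` K) \<inter> I_card \<Omega> \<mu>"
      using V by blast
    moreover have "openin (T_P \<Omega>) (\<Union> (V ` K))"
      using V by auto
    moreover have "\<Union> K \<subseteq> \<Omega> \<rightarrow>\<^sub>E \<Omega>"
      using UN by (simp add: Union_least)
    ultimately show ?case by blast
  next
    case (Basis A)
    consider "openin (T_P \<Omega>) A" | "A \<subseteq> (\<Omega> \<rightarrow>\<^sub>E \<Omega>) - I_card \<Omega> \<mu>"
      | "I_card \<Omega> \<mu> \<subseteq> A" "A \<subseteq> \<Omega> \<rightarrow>\<^sub>E \<Omega>"
      using Basis I_card_subset[of \<Omega> \<mu>] by (auto simp: opens_def T_I1_def T_I2_def)
    then show ?case
    proof cases
      case 1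
      then show ?thesis using openin_subset[OF 1] by auto
    next
      case 2
      then show ?thesis by (auto intro: exI[of _ "{}"])
    next
      case 3
      then show ?thesis
        \<comment> \<open>A set containing the whole ideal has the same trace on it as the whole
          monoid.\<close>
        using openin_topspace[of "T_P \<Omega>"] by (auto intro!: exI[of _ "\<Omega> \<rightarrow>\<^sub>E \<Omega>"])
    qed
  qed
next
  assume "?R U"
  then obtain V where V: "openin (T_P \<Omega>) V" "U \<inter> I_card \<Omega> \<mu> = V \<inter> I_card \<Omega> \<mu>"
    and "U \<subseteq> \<Omega> \<rightarrow>\<^sub>E \<Omega>" by blast
  then have "openin (T_PI 2 \<Omega> \<mu>) (V \<inter> I_card \<Omega> \<mu> \<union> (U - I_card \<Omega> \<mu>))"
    by (intro openin_Un openin_Int openin_T_PI_2_I_card T_PI_subbase(1)[OF V(1)] T_PI_subbase(2)) blast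
  moreover have "U = V \<inter> I_card \<Omega> \<mu> \<union> (U - I_card \<Omega> \<mu>)"
    using V by auto
  ultimately show "openin (T_PI 2 \<Omega> \<mu>) U" by simp
qed

section \<open>Separation and continuity for the generated topologies\<close>

lemma topspace_T_PI:
  assumes "i \<in> {1, 2}"
  shows "topspace (T_PI i \<Omega> \<mu>) = \<Omega> \<rightarrow>\<^sub>E \<Omega>"
proof
  show "topspace (T_PI i \<Omega> \<mu>) \<subseteq> \<Omega> \<rightarrow>\<^sub>E \<Omega>"
    using assms openin_topspace[of "T_PI i \<Omega> \<mu>"] unfolding insert_iff empty_iff
    by (elim disjE) (simp_all only: openin_T_PI_1 openin_T_PI_2)
  show "\<Omega> \<rightarrow>\<^sub>E \<Omega> \<subseteq> topspace (T_PI i \<Omega> \<mu>)"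
    using openin_subset[OF T_PI_subbase(1)[OF openin_topspace]] by simp
qed

lemma Hausdorff_T_PI:
  assumes "i \<in> {1, 2}"
  shows "Hausdorff_space (T_PI i \<Omega> \<mu>)"
  unfolding Hausdorff_space_def topspace_T_PI[OF assms]
proof (intro allI impI)
  fix f g assume "f \<in> \<Omega> \<rightarrow>\<^sub>E \<Omega> \<and> g \<in> \<Omega> \<rightarrow>\<^sub>E \<Omega> \<and> f \<noteq> g"
  then obtain U V where UV: "openin (T_P \<Omega>) U" "openin (T_P \<Omega>) V" "f \<in> U" "g \<in> V" "disjnt U V"
    using Hausdorff_T_P[of \<Omega>] unfolding Hausdorff_space_def topspace_T_P by metis
  show "\<exists>U V. openin (T_PI i \<Omega> \<mu>) U \<and> openin (T_PI i \<Omega> \<mu>) V \<and> f \<in> U \<and> g \<in> V \<and> disjnt U V"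
    by (intro exI[of _ U] exI[of _ V] conjI T_PI_subbase(1) UV)
qed

lemma topological_semigroup_T_PI:
  assumes i: "i \<in> {1, 2}"
  shows "topological_semigroup (\<Omega> \<rightarrow>\<^sub>E \<Omega>) (self_map_mult \<Omega>) (T_PI i \<Omega> \<mu>)"
proof (rule topological_semigroupI[OF topspace_T_PI[OF i]])
  fix f g U
  assume fg: "f \<in> \<Omega> \<rightarrow>\<^sub>E \<Omega>" "g \<in> \<Omega> \<rightarrow>\<^sub>E \<Omega>" and U: "openin (T_PI i \<Omega> \<mu>) U" "self_map_mult \<Omega> f g \<in> U"
  let ?I = "I_card \<Omega> \<mu>"
  show "\<exists>V W. openin (T_PI i \<Omega> \<mu>) V \<and> openin (T_PI i \<Omega> \<mu>) W \<and> f \<in> V \<and> g \<in> W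
            \<and> (\<forall>f'\<in>V. \<forall>g'\<in>W. self_map_mult \<Omega> f' g' \<in> U)"
  proof (cases "f \<in> ?I \<or> g \<in> ?I")
    case False
    \<comment> \<open>Both factors are isolated, so the rectangle can be a single point.\<close>
    then show ?thesis
      using fg U by (intro exI[of _ "{f}"] exI[of _ "{g}"] conjI T_PI_subbase(2)) auto
  next
    case True
    then have fgI: "self_map_mult \<Omega> f g \<in> ?I"
      using I_card_ideal fg by blast
    from i consider "i = 1" | "i = 2" by blast
    then show ?thesis
    proof cases
      case 1
      \<comment> \<open>The product lies in the ideal, where openness of \<open>U\<close> supplies a
        pointwise neighbourhood inside \<open>U\<close>.\<close>
      then obtain O' where O': "openin (T_P \<Omega>) O'" "O' \<subseteq> U" "self_map_mult \<Omega> f g \<in> O'"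
        using U fgI unfolding 1 openin_T_PI_1 by blast
      obtain V W where VW: "openin (T_P \<Omega>) V" "openin (T_P \<Omega>) W" "f \<in> V" "g \<in> W"
        "\<forall>f'\<in>V. \<forall>g'\<in>W. self_map_mult \<Omega> f' g' \<in> O'"
        using T_P_mult_nhds[OF fg O'(1,3)] .
      show ?thesis
        by (intro exI[of _ V] exI[of _ W] conjI T_PI_subbase(1) VW(1-4))
          (use VW(5) O'(2) in blast)
    next
      case 2
      then obtain O' where O': "openin (T_P \<Omega>) O'" "U \<inter> ?I = O' \<inter> ?I"
        using U by (auto simp: openin_T_PI_2)
      then have "self_map_mult \<Omega> f g \<in> O'"
        using U fgI by blast
      from T_P_mult_nhds[OF fg O'(1) this]
      obtain V W where VW: "openin (T_P \<Omega>) V" "openin (T_P \<Omega>) W" "f \<in> V" "g \<in> W"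
        "\<forall>f'\<in>V. \<forall>g'\<in>W. self_map_mult \<Omega> f' g' \<in> O'" .
      have VW': "openin (T_PI i \<Omega> \<mu>) V" "openin (T_PI i \<Omega> \<mu>) W"
        "openin (T_PI i \<Omega> \<mu>) (V \<inter> ?I)" "openin (T_PI i \<Omega> \<mu>) (W \<inter> ?I)"
        using VW(1,2)[THEN T_PI_subbase(1)] openin_T_PI_2_I_card
        unfolding 2 by (blast intro: openin_Int)+
      have sub: "V \<subseteq> \<Omega> \<rightarrow>\<^sub>E \<Omega>" "W \<subseteq> \<Omega> \<rightarrow>\<^sub>E \<Omega>"
        using openin_subset[OF VW(1)] openin_subset[OF VW(2)] by simp_all
      \<comment> \<open>Here \<open>O'\<close> need not lie in \<open>U\<close>; the two agree only
        on the ideal. One factor in the ideal forces the product into it, so it suffices to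
        intersect the neighbourhood of that factor with the ideal.\<close>
      have *: "self_map_mult \<Omega> f' g' \<in> U" if "f' \<in> V" "g' \<in> W" "f' \<in> ?I \<or> g' \<in> ?I" for f' g'
      proof -
        have "self_map_mult \<Omega> f' g' \<in> O' \<inter> ?I"
          using VW(5) that I_card_ideal[OF subsetD[OF sub(1)] subsetD[OF sub(2)]] by simp
        then show ?thesis using O'(2) by blast
      qed
      show ?thesis
      proof (cases "f \<in> ?I")
        case True
        then show ?thesis
          using VW(3,4) * by (intro exI[of _ "V \<inter> ?I"] exI[of _ W] conjI VW') simp_all
      next
        case False
        then show ?thesis
          using VW(3,4) * \<open>f \<in> ?I \<or> g \<in> ?I\<close>
          by (intro exI[of _ V] exI[of _ "W \<inter> ?I"] conjI VW') simp_all
      qed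
    qed
  qed
qed

section \<open>Strictness of the inclusions\<close>

text \<open>A neighbourhood of \<open>f\<close> leaves the value free at some point of the infinite
  set \<open>\<Omega>\<close>, so \<open>f\<close> can be changed there. Drawing the new value from
  \<open>B\<close> controls the image of the new map.\<close>

lemma T_P_nhd_perturb:
  assumes "infinite \<Omega>" "openin (T_P \<Omega>) V" "f \<in> V" "\<And>z. z \<in> \<Omega> \<Longrightarrow> \<exists>y\<in>B. y \<noteq> f z" "B \<subseteq> \<Omega>"
  obtains g where "g \<in> V" "g \<noteq> f" "g ` \<Omega> \<subseteq> f ` \<Omega> \<union> B"
proof -
  obtain F where F: "finite F" "F \<subseteq> \<Omega>" "agree \<Omega> f F \<subseteq> V"
    using openin_T_P_agree[OF assms(2,3)] .
  obtain z where z: "z \<in> \<Omega>" "z \<notin> F"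
    using assms(1) F(1) by (meson finite_subset subsetI)
  obtain y where y: "y \<in> B" "y \<noteq> f z"
    using assms(4) z by blast
  have "f \<in> \<Omega> \<rightarrow>\<^sub>E \<Omega>"
    using assms(2,3) openin_subset by fastforce
  then have "f(z := y) \<in> agree \<Omega> f F"
    using z y assms(5) by (auto simp: agree_def PiE_iff extensional_def)
  moreover have "f(z := y) \<noteq> f"
    using y by (metis fun_upd_same)
  ultimately show ?thesis
    using F(3) y by (intro that[of "f(z := y)"]) auto
qed

lemma T_P_no_isolated:
  assumes "infinite \<Omega>"
  shows "\<not> openin (T_P \<Omega>) {f}"
proof
  assume "openin (T_P \<Omega>) {f}"
  moreover have "\<exists>y\<in>\<Omega>. y \<noteq> f z" for z
    using assms by (metis finite.emptyI finite_insert finite_subset insertI1 subsetI)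
  ultimately show False
    using T_P_nhd_perturb[OF assms, of "{f}" f \<Omega>] by blast
qed

text \<open>Supplies the map that witnesses strictness: its image has exactly the cardinality
  \<open>\<mu>\<close>, and more than one point, so it can be perturbed without enlarging the
  image.\<close>

lemma cardinals_upto_image:
  assumes "\<mu> \<in> cardinals_upto \<Omega>"
  obtains f where "f \<in> \<Omega> \<rightarrow>\<^sub>E \<Omega>" "|f ` \<Omega>| =o \<mu>" "\<forall>z. \<exists>y\<in>f ` \<Omega>. y \<noteq> z"
proof -
  have mu: "Card_order \<mu>" "cone <o \<mu>" "\<mu> \<le>o |\<Omega>|"
    using assms by (auto simp: cardinals_upto_def)
  have "|Field \<mu>| \<le>o |\<Omega>|"
    using mu card_of_Field_ordIso ordIso_ordLeq_trans by blast
  then obtain h where h: "inj_on h (Field \<mu>)" "h ` Field \<mu> \<subseteq> \<Omega>"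
    by (meson card_of_ordLeq)
  define A where "A = h ` Field \<mu>"
  have "|Field \<mu>| =o |A|"
    using h by (auto simp: A_def card_of_ordIso[symmetric] intro: inj_on_imp_bij_betw)
  then have A: "|A| =o \<mu>"
    using card_of_Field_ordIso[OF mu(1)] ordIso_symmetric ordIso_transitive by blast
  have two: "\<exists>y\<in>A. y \<noteq> z" for z
  proof (rule ccontr)
    assume "\<not> ?thesis"
    \<comment> \<open>If some \<open>z\<close> were the only possible element of \<open>A\<close>,
      then \<open>A\<close> would embed in the one-point set whose cardinal is \<open>cone\<close>,
      against \<open>cone <o \<mu>\<close>.\<close>
    then have "inj_on (\<lambda>_. ()) A"
      by (metis inj_onI)
    then have "|A| \<le>o |{()}|"
      by (intro card_of_ordLeq[THEN iffD1] exI[of _ "\<lambda>_. ()"]) auto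
    then have "\<mu> \<le>o cone"
      using A unfolding BNF_Cardinal_Arithmetic.cone_def by (meson ordIso_ordLeq_trans ordIso_symmetric)
    then show False
      using mu(2) not_ordLess_ordLeq by blast
  qed
  obtain a where a: "a \<in> A" using two by blast
  \<comment> \<open>A retraction of \<open>\<Omega>\<close> onto \<open>A\<close>.\<close>
  define f where "f x = (if x \<in> A then x else if x \<in> \<Omega> then a else undefined)" for x
  have "f ` \<Omega> = A" "f \<in> \<Omega> \<rightarrow>\<^sub>E \<Omega>"
    using h a by (auto simp: f_def A_def PiE_iff extensional_def)
  with A two show ?thesis
    by (intro that[of f]) auto
qed

text \<open>A map with image of size \<open>\<mu>\<close> lies outside the ideal and becomes
  isolated, while the pointwise topology has no isolated points.\<close>

lemma T_P_psubset_T_PI: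
  assumes "infinite \<Omega>" "\<mu> \<in> cardinals_upto \<Omega>"
  shows "opens (T_P \<Omega>) \<subset> opens (T_PI i \<Omega> \<mu>)"
proof -
  obtain f where f: "f \<in> \<Omega> \<rightarrow>\<^sub>E \<Omega>" "|f ` \<Omega>| =o \<mu>" "\<forall>z. \<exists>y\<in>f ` \<Omega>. y \<noteq> z"
    using cardinals_upto_image[OF assms(2)] .
  then have "f \<notin> I_card \<Omega> \<mu>"
    using not_ordLess_ordIso by (auto simp: I_card_def)
  then have "openin (T_PI i \<Omega> \<mu>) {f}"
    using f by (intro T_PI_subbase(2)) auto
  from opens_psubsetI[OF _ this T_P_no_isolated[OF assms(1)]] show ?thesis
    using T_PI_subbase(1) by metis
qed

text \<open>A smaller ideal leaves more points isolated. A map with image of size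
  \<open>\<mu>\<close> lies outside the smaller ideal but inside the larger one, where perturbations
  of it accumulate.\<close>

lemma T_PI_strict_antimono:
  assumes "infinite \<Omega>" "i \<in> {1, 2}" "\<mu> \<in> cardinals_upto \<Omega>" "\<mu> <o \<kappa>"
  shows "opens (T_PI i \<Omega> \<kappa>) \<subset> opens (T_PI i \<Omega> \<mu>)"
proof -
  have I: "I_card \<Omega> \<mu> \<subseteq> I_card \<Omega> \<kappa>"
    using assms(4) by (intro I_card_mono ordLess_imp_ordLeq)
  have sub: "openin (T_PI i \<Omega> \<mu>) U" if "openin (T_PI i \<Omega> \<kappa>) U" for U
    using assms(2)
  proof (elim insertE emptyE)
    assume i: "i = 1"
    with that I show ?thesis unfolding i openin_T_PI_1 by blast
  next
    assume "i = 2"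
    with that obtain V where "U \<subseteq> \<Omega> \<rightarrow>\<^sub>E \<Omega>" "openin (T_P \<Omega>) V"
      "U \<inter> I_card \<Omega> \<kappa> = V \<inter> I_card \<Omega> \<kappa>" by (auto simp: openin_T_PI_2)
    moreover from this I have "U \<inter> I_card \<Omega> \<mu> = V \<inter> I_card \<Omega> \<mu>" by blast
    ultimately show ?thesis using \<open>i = 2\<close> by (auto simp: openin_T_PI_2)
  qed
  obtain f where f: "f \<in> \<Omega> \<rightarrow>\<^sub>E \<Omega>" "|f ` \<Omega>| =o \<mu>" "\<forall>z. \<exists>y\<in>f ` \<Omega>. y \<noteq> z"
    using cardinals_upto_image[OF assms(3)] .
  have "f \<notin> I_card \<Omega> \<mu>"
    using f not_ordLess_ordIso by (auto simp: I_card_def)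
  then have "openin (T_PI i \<Omega> \<mu>) {f}"
    using f by (intro T_PI_subbase(2)) auto
  moreover have "\<not> openin (T_PI i \<Omega> \<kappa>) {f}"
  proof
    assume op: "openin (T_PI i \<Omega> \<kappa>) {f}"
    have small: "g \<in> I_card \<Omega> \<kappa>" if "g \<in> \<Omega> \<rightarrow>\<^sub>E \<Omega>" "g ` \<Omega> \<subseteq> f ` \<Omega>" for g
      using that f(2) assms(4) card_of_mono1[OF that(2)]
      by (auto simp: I_card_def intro: ordLeq_ordLess_trans ordLeq_ordIso_trans)
    then have fI: "f \<in> I_card \<Omega> \<kappa>" using f(1) by blast
    \<comment> \<open>For either index, openness of the singleton gives a pointwise open set that
      meets the larger ideal only in \<open>f\<close>.\<close>
    obtain V where V: "openin (T_P \<Omega>) V" "V \<inter> I_card \<Omega> \<kappa> = {f}"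
    proof -
      from assms(2) consider "i = 1" | "i = 2" by blast
      then show thesis
      proof cases
        case 1
        with op fI obtain V where "openin (T_P \<Omega>) V" "V \<subseteq> {f}" "f \<in> V"
          unfolding 1 openin_T_PI_1 by blast
        with fI show thesis by (intro that[of V]) auto
      next
        case 2
        with op fI obtain V where "openin (T_P \<Omega>) V" "{f} \<inter> I_card \<Omega> \<kappa> = V \<inter> I_card \<Omega> \<kappa>"
          by (auto simp: openin_T_PI_2)
        with fI show thesis by (intro that[of V]) auto
      qed
    qed
    \<comment> \<open>New values are taken inside the image, so the perturbed map stays in \<open>I\<close>.\<close>
    have "f ` \<Omega> \<subseteq> \<Omega>" "f \<in> V" using f(1) V(2) by auto
    then obtain g where g: "g \<in> V" "g \<noteq> f" "g ` \<Omega> \<subseteq> f ` \<Omega> \<union> f ` \<Omega>"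
      using T_P_nhd_perturb[OF assms(1) V(1) _ f(3)[rule_format]] by blast
    moreover have "g \<in> \<Omega> \<rightarrow>\<^sub>E \<Omega>"
      using g(1) openin_subset[OF V(1)] by auto
    ultimately show False
      using V(2) small by blast
  qed
  ultimately show ?thesis
    using sub opens_psubsetI by metis
qed

text \<open>The ideal itself separates the two topologies: every pointwise neighbourhood of a
  constant map contains maps with image of full cardinality.\<close>

lemma T_PI_1_psubset_T_PI_2:
  assumes "infinite \<Omega>" "\<mu> \<in> cardinals_upto \<Omega>"
  shows "opens (T_PI 1 \<Omega> \<mu>) \<subset> opens (T_PI 2 \<Omega> \<mu>)"
proof -
  have mu: "cone <o \<mu>" "\<mu> \<le>o |\<Omega>|"
    using assms by (auto simp: cardinals_upto_def)
  have sub: "openin (T_PI 2 \<Omega> \<mu>) U" if "openin (T_PI 1 \<Omega> \<mu>) U" for U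
    using that unfolding openin_T_PI_1 openin_T_PI_2 by blast
  have "\<not> openin (T_PI 1 \<Omega> \<mu>) (I_card \<Omega> \<mu>)"
  proof
    assume "openin (T_PI 1 \<Omega> \<mu>) (I_card \<Omega> \<mu>)"
    \<comment> \<open>The pointwise open witness is squeezed between the ideal and itself.\<close>
    then have op: "openin (T_P \<Omega>) (I_card \<Omega> \<mu>)"
      unfolding openin_T_PI_1 by (metis Int_absorb subset_antisym)
    obtain c where c: "c \<in> \<Omega>" using assms(1) by fastforce
    define f where "f = (\<lambda>x\<in>\<Omega>. c)"
    have "|f ` \<Omega>| \<le>o |{()}|"
      by (intro card_of_ordLeq[THEN iffD1] exI[of _ "\<lambda>_. ()"]) (auto simp: inj_on_def f_def)
    then have "|f ` \<Omega>| <o \<mu>"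
      using mu(1) unfolding BNF_Cardinal_Arithmetic.cone_def by (rule ordLeq_ordLess_trans)
    then have "f \<in> I_card \<Omega> \<mu>"
      using c by (auto simp: I_card_def f_def)
    then obtain F where F: "finite F" "F \<subseteq> \<Omega>" "agree \<Omega> f F \<subseteq> I_card \<Omega> \<mu>"
      using openin_T_P_agree[OF op] by blast
    \<comment> \<open>Constant on \<open>F\<close> as \<open>f\<close> requires, the identity
      elsewhere, so the image contains \<open>\<Omega> - F\<close>.\<close>
    define g where "g = (\<lambda>x\<in>\<Omega>. if x \<in> F then c else x)"
    have "g \<in> agree \<Omega> f F"
      using F(2) c by (auto simp: agree_def g_def f_def)
    then have "|g ` \<Omega>| <o \<mu>"
      using F(3) by (auto simp: I_card_def)
    moreover have "|\<Omega> - F| \<le>o |g ` \<Omega>|"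
      by (rule card_of_mono1) (auto simp: g_def image_iff)
    \<comment> \<open>Removing a finite set does not lower an infinite cardinality.\<close>
    moreover have "|\<Omega>| \<le>o |\<Omega> - F|"
    proof -
      have inf: "infinite (\<Omega> - F)" using assms(1) F(1) by simp
      have "|F| \<le>o |\<Omega> - F|"
        using F(1) inf
        by (intro ordLess_imp_ordLeq finite_ordLess_infinite) (simp_all only: Field_card_of card_of_well_order_on not_False_eq_True)
      then have "|(\<Omega> - F) \<union> F| \<le>o |\<Omega> - F|"
        using inf by (intro card_of_Un_ordLeq_infinite_Field)
          (simp_all only: Field_card_of card_of_card_order_on card_of_mono1 not_False_eq_True subset_refl)
      moreover have "(\<Omega> - F) \<union> F = \<Omega>" using F(2) by blast
      ultimately show ?thesis by simp
    qed
    ultimately have "|\<Omega>| <o |\<Omega>|"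
      using mu(2) by (meson ordLeq_transitive ordLeq_ordLess_trans ordLess_ordLeq_trans)
    then show False
      using not_ordLess_ordIso card_of_refl by blast
  qed
  from opens_psubsetI[OF _ openin_T_PI_2_I_card this] show ?thesis
    using sub by metis
qed

section \<open>The discrete case\<close>

text \<open>Two distinct values would embed the booleans, whose cardinal is \<open>ctwo\<close>,
  into the image.\<close>

lemma I_card_ctwo_constant:
  assumes "f \<in> I_card \<Omega> ctwo" "x \<in> \<Omega>" "y \<in> \<Omega>"
  shows "f x = f y"
proof (rule ccontr)
  assume "f x \<noteq> f y"
  then have "|UNIV :: bool set| \<le>o |f ` \<Omega>|"
    using assms
    by (intro card_of_ordLeq[THEN iffD1] exI[of _ "\<lambda>b. if b then f x else f y"])
      (auto simp: inj_on_def)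
  moreover have "|f ` \<Omega>| <o |UNIV :: bool set|"
    using assms by (simp add: I_card_def ctwo_def)
  ultimately show False
    using not_ordLess_ordLeq by blast
qed

text \<open>Non-constant maps are isolated already, and a constant map is determined among constant
  maps by its value at one point. The index \<open>ctwo\<close> is a relation on
  \<open>bool\<close>, which is possible because the type of the index is independent of that of
  \<open>\<Omega>\<close>.\<close>

lemma T_PI_2_ctwo:
  assumes "\<Omega> \<noteq> {}"
  shows "T_PI 2 \<Omega> ctwo = discrete_topology (\<Omega> \<rightarrow>\<^sub>E \<Omega>)"
proof -
  obtain c where c: "c \<in> \<Omega>" using assms by blast
  have "openin (T_PI 2 \<Omega> ctwo) {f}" if f: "f \<in> \<Omega> \<rightarrow>\<^sub>E \<Omega>" for f
  proof (cases "f \<in> I_card \<Omega> ctwo")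
    case False
    then show ?thesis using f by (intro T_PI_subbase(2)) auto
  next
    case True
    have "g = f" if "g \<in> agree \<Omega> f {c}" "g \<in> I_card \<Omega> ctwo" for g
    proof (rule PiE_ext)
      show "g \<in> \<Omega> \<rightarrow>\<^sub>E \<Omega>" "f \<in> \<Omega> \<rightarrow>\<^sub>E \<Omega>"
        using that f by (auto simp: agree_def)
      show "g x = f x" if "x \<in> \<Omega>" for x
        using I_card_ctwo_constant[OF True that c] I_card_ctwo_constant[OF _ that c, of g]
          \<open>g \<in> agree \<Omega> f {c}\<close> \<open>g \<in> I_card \<Omega> ctwo\<close> by (simp add: agree_def)
    qed
    moreover have "f \<in> agree \<Omega> f {c}" using f by (simp add: agree_def)
    ultimately have "{f} \<inter> I_card \<Omega> ctwo = agree \<Omega> f {c} \<inter> I_card \<Omega> ctwo"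
      using True by blast
    then show ?thesis
      unfolding openin_T_PI_2 using f c openin_agree[OF f, of "{c}"] by blast
  qed
  then show ?thesis
    using discrete_topology_unique[of "\<Omega> \<rightarrow>\<^sub>E \<Omega>" "T_PI 2 \<Omega> ctwo"] topspace_T_PI[of 2 \<Omega> ctwo]
    by auto
qed

theorem proposition4p1:
  fixes \<Omega> :: "'a set"
  assumes "infinite \<Omega>"
  shows "Hausdorff_space (T_P \<Omega>)
    \<and> topological_semigroup (\<Omega> \<rightarrow>\<^sub>E \<Omega>) (self_map_mult \<Omega>) (T_P \<Omega>)
    \<and> (\<forall>i\<in>{1,2}. \<forall>\<mu>\<in>cardinals_upto \<Omega>.
          Hausdorff_space (T_PI i \<Omega> \<mu>)
          \<and> topological_semigroup (\<Omega> \<rightarrow>\<^sub>E \<Omega>) (self_map_mult \<Omega>) (T_PI i \<Omega> \<mu>))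
    \<and> (\<forall>i\<in>{1,2}. \<forall>\<mu>\<in>cardinals_upto \<Omega>. opens (T_P \<Omega>) \<subset> opens (T_PI i \<Omega> \<mu>))
    \<and> (\<forall>i\<in>{1,2}. \<forall>\<mu>\<in>cardinals_upto \<Omega>. \<forall>\<kappa>\<in>cardinals_upto \<Omega>.
          \<mu> <o \<kappa> \<longrightarrow> opens (T_PI i \<Omega> \<kappa>) \<subset> opens (T_PI i \<Omega> \<mu>))
    \<and> (\<forall>\<mu>\<in>cardinals_upto \<Omega>. opens (T_PI 1 \<Omega> \<mu>) \<subset> opens (T_PI 2 \<Omega> \<mu>))
    \<and> T_PI 2 \<Omega> ctwo = discrete_topology (\<Omega> \<rightarrow>\<^sub>E \<Omega>)"
proof (intro conjI ballI impI)
  show "T_PI 2 \<Omega> ctwo = discrete_topology (\<Omega> \<rightarrow>\<^sub>E \<Omega>)"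
    using assms by (intro T_PI_2_ctwo) auto
qed (assumption | rule assms Hausdorff_T_P Hausdorff_T_PI topological_semigroup_T_P
    topological_semigroup_T_PI T_P_psubset_T_PI T_PI_strict_antimono T_PI_1_psubset_T_PI_2)+

end
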